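(* Let $k \geq 1$, let $i \in \{0,1,2,3\}$, and let $G$ be a connected $n$-vertex graph such that $(G,k)$ is not special. Then \[\iota(G,\mathcal{F}_{i,k}) \leq \left\lfloor \frac{n}{k+1} \right\rfloor.\] Moreover, equality holds if $i \in \{1,2,3\}$ and $G = B_{n,k}$.
   Context: All graphs are finite and simple. For $D \subseteq V(G)$, $N[D]$ is the union of the closed neighbourhoods of the vertices in $D$. Given a set $\mathcal{F}$ of graphs, an $\mathcal{F}$-graph is a graph isomorphic to a member of $\mathcal{F}$. A set $D \subseteq V(G)$ is $\mathcal{F}$-isolating if $G - N[D]$ contains no $\mathcal{F}$-graph as a subgraph, and $\iota(G,\mathcal{F})$ is the minimum size of an $\mathcal{F}$-isolating set of $G$. $\mathcal{F}_{0,k} = \{K_{1,k}\}$ (the star with $k$ leaves); $\mathcal{F}_{1,k}$ is the set of regular graphs of degree at least $k-1$; $\mathcal{F}_{2,k}$ is the set of graphs with chromatic number at least $k$; $\mathcal{F}_{3,k} = \mathcal{F}_{0,k} \cup \mathcal{F}_{1,k} \cup \mathcal{F}_{2,k}$. The pair $(G,k)$ is special if either $G$ is a $k$-clique, or $k=2$ and $G$ is a $5$-cycle. The graph $B_{n,k}$: let $q = \lfloor n/(k+1) \rfloor$ and $n = q(k+1)+r$ with $0 \le r \le k$. If $q=0$, $B_{n,k} = K_r$. If $q \geq 1$, take pairwise vertex-disjoint cliques $B_1,\dots,B_q$ on $k+1$ vertices and $B_{q+1}$ on $r$ vertices; let $q'=q$ if $r=0$ and $q'=q+1$ otherwise; choose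 $b_i \in V(B_i)$ for $i \in [q']$; $B_{n,k}$ has vertex set $\bigcup_{i=1}^{q'} V(B_i)$ and edge set $\{b_ib_{i+1} : i \in [q'-1]\} \cup \bigcup_{i=1}^{q'} E(B_i)$. *)

theory Defs
  imports Main
begin

text \<open>A finite simple graph is a pair (V, E) of a vertex set and a set of 2-element edges.\<close>
type_synonym 'a graph = "'a set \<times> 'a set set"

definition wf_graph :: "'a graph \<Rightarrow> bool" where
  "wf_graph G \<longleftrightarrow> finite (fst G) \<and>
     snd G \<subseteq> {{u, v} | u v. u \<in> fst G \<and> v \<in> fst G \<and> u \<noteq> v}"

definition subgraph :: "'a graph \<Rightarrow> 'a graph \<Rightarrow> bool" where
  "subgraph H G \<longleftrightarrow> wf_graph H \<and> fst H \<subseteq> fst G \<and> snd H \<subseteq> snd G"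

text \<open>N[D]: union of closed neighbourhoods of the vertices of D.\<close>
definition closed_nbhd :: "'a graph \<Rightarrow> 'a set \<Rightarrow> 'a set" where
  "closed_nbhd G D = D \<union> {v \<in> fst G. \<exists>u\<in>D. {u, v} \<in> snd G}"

text \<open>G - S: delete the vertices in S (and all incident edges).\<close>
definition delete_vertices :: "'a graph \<Rightarrow> 'a set \<Rightarrow> 'a graph" where
  "delete_vertices G S = (fst G - S, {e \<in> snd G. e \<inter> S = {}})"

definition graph_iso :: "'a graph \<Rightarrow> 'b graph \<Rightarrow> bool" where
  "graph_iso G H \<longleftrightarrow> (\<exists>f. bij_betw f (fst G) (fst H) \<and>
     (\<forall>u\<in>fst G. \<forall>v\<in>fst G. {u, v} \<in> snd G \<longleftrightarrow> {f u, f v} \<in> snd H))"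

text \<open>A family of graphs is given as an isomorphism-closed predicate on graphs.
  D is F-isolating if D is a set of vertices and G - N[D] has no subgraph that is an F-graph.\<close>
definition isolating :: "'a graph \<Rightarrow> ('a graph \<Rightarrow> bool) \<Rightarrow> 'a set \<Rightarrow> bool" where
  "isolating G F D \<longleftrightarrow> D \<subseteq> fst G \<and>
     \<not> (\<exists>H. subgraph H (delete_vertices G (closed_nbhd G D)) \<and> F H)"

definition iota :: "'a graph \<Rightarrow> ('a graph \<Rightarrow> bool) \<Rightarrow> nat" where
  "iota G F = (LEAST m. \<exists>D. isolating G F D \<and> card D = m)"

text \<open>The star K_{1,k} (centre 0, leaves 1..k).\<close>
definition star_graph :: "nat \<Rightarrow> nat graph" where
  "star_graph k = ({0..k}, {{0, l} | l. 1 \<le> l \<and> l \<le> k})"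

definition complete_graph :: "nat \<Rightarrow> nat graph" where
  "complete_graph m = ({0..<m}, {{u, v} | u v. u < m \<and> v < m \<and> u \<noteq> v})"

definition cycle5 :: "nat graph" where
  "cycle5 = ({0..<5}, {{i, (i + 1) mod 5} | i. i < 5})"

definition degree :: "'a graph \<Rightarrow> 'a \<Rightarrow> nat" where
  "degree G v = card {u \<in> fst G. {u, v} \<in> snd G}"

definition proper_colouring :: "'a graph \<Rightarrow> nat \<Rightarrow> ('a \<Rightarrow> nat) \<Rightarrow> bool" where
  "proper_colouring G c f \<longleftrightarrow> (\<forall>v\<in>fst G. f v < c) \<and>
     (\<forall>u\<in>fst G. \<forall>v\<in>fst G. {u, v} \<in> snd G \<longrightarrow> f u \<noteq> f v)"

definition chromatic_number :: "'a graph \<Rightarrow> nat" where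
  "chromatic_number G = (LEAST c. \<exists>f. proper_colouring G c f)"

text \<open>The families F_{0,k}, ..., F_{3,k} (graphs are nonempty).\<close>
definition fam0 :: "nat \<Rightarrow> 'a graph \<Rightarrow> bool" where
  "fam0 k H \<longleftrightarrow> graph_iso H (star_graph k)"

definition fam1 :: "nat \<Rightarrow> 'a graph \<Rightarrow> bool" where
  "fam1 k H \<longleftrightarrow> fst H \<noteq> {} \<and> (\<exists>d. d \<ge> k - 1 \<and> (\<forall>v\<in>fst H. degree H v = d))"

definition fam2 :: "nat \<Rightarrow> 'a graph \<Rightarrow> bool" where
  "fam2 k H \<longleftrightarrow> fst H \<noteq> {} \<and> chromatic_number H \<ge> k"

definition fam :: "nat \<Rightarrow> nat \<Rightarrow> 'a graph \<Rightarrow> bool" where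
  "fam i k H = (if i = 0 then fam0 k H else if i = 1 then fam1 k H
                else if i = 2 then fam2 k H else (fam0 k H \<or> fam1 k H \<or> fam2 k H))"

definition connected_graph :: "'a graph \<Rightarrow> bool" where
  "connected_graph G \<longleftrightarrow> fst G \<noteq> {} \<and>
     (\<forall>u\<in>fst G. \<forall>v\<in>fst G. (u, v) \<in> {(x, y). {x, y} \<in> snd G}\<^sup>*)"

definition special :: "'a graph \<Rightarrow> nat \<Rightarrow> bool" where
  "special G k \<longleftrightarrow> graph_iso G (complete_graph k) \<or> (k = 2 \<and> graph_iso G cycle5)"

text \<open>B_{n,k} on vertices 0..n-1: block j = {v. v div (k+1) = j} is a clique,
  b_j = j*(k+1) is the chosen vertex of block j, and b_j b_{j+1} are joined.\<close>
definition B_graph :: "nat \<Rightarrow> nat \<Rightarrow> nat graph" where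
  "B_graph n k = ({0..<n},
     {{u, v} | u v. u < n \<and> v < n \<and> u \<noteq> v \<and> u div (k + 1) = v div (k + 1)} \<union>
     {{j * (k + 1), (j + 1) * (k + 1)} | j. (j + 1) * (k + 1) < n})"

end

theory Submission
  imports Defs
begin

text \<open>
  Call a graph sparse if its maximum degree is below \<open>k\<close> and no subgraph has minimum degree at
  least \<open>k - 1\<close>; sparse graphs contain no member of any of the four families, so it suffices to
  dominate away a non-sparse part. In a minimal counterexample \<open>S\<close> one removes a set \<open>X\<close>
  covered by few vertices \<open>D0\<close>: the rest is handled by minimality, and special components of
  \<open>S - X\<close> cost nothing extra unless they avoid \<open>N[D0]\<close>. If all degrees are below \<open>k\<close>, then
  \<open>S\<close> is regular and one vertex suffices. Otherwise remove \<open>N[v]\<close> for a vertex \<open>v\<close> of degree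
  at least \<open>k\<close>; some component \<open>H\<close> of \<open>S - N[v]\<close> is special. Removing \<open>X = H \<union> {x}\<close> with
  \<open>x \<in> N(v)\<close> adjacent to \<open>H\<close> shows first that every such \<open>H\<close> has links to two vertices of
  \<open>N(v)\<close>, and then that the only possible obstruction is the component of \<open>v\<close>. Suitable
  choices of \<open>D0\<close> rule out a 5-cycle \<open>H\<close>, and force \<open>S\<close> itself to be a 5-cycle if \<open>H\<close> is a
  clique.
\<close>

section \<open>Isolation inside vertex sets of a fixed graph\<close>

locale isolation =
  fixes adj :: "'a \<Rightarrow> 'a \<Rightarrow> bool" and k :: nat
  assumes adj_sym: "adj u w \<Longrightarrow> adj w u"
    and adj_irrefl: "\<not> adj u u"
    and k_pos: "k \<ge> 1"
begin

definition nb :: "'a set \<Rightarrow> 'a \<Rightarrow> 'a set" where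
  "nb S u = {w \<in> S. adj u w}"

text \<open>Not cut down to any \<open>S\<close>, so that one \<open>nbhd D\<close> serves every
  vertex set that remains after a deletion.\<close>

definition nbhd :: "'a set \<Rightarrow> 'a set" where
  "nbhd D = D \<union> {w. \<exists>u\<in>D. adj u w}"

definition separated :: "'a set \<Rightarrow> 'a set \<Rightarrow> bool" where
  "separated A B \<longleftrightarrow> (\<forall>a\<in>A. \<forall>b\<in>B. \<not> adj a b)"

text \<open>The cut form of connectedness: it yields a crossing edge directly, without
  paths.\<close>

definition conn :: "'a set \<Rightarrow> bool" where
  "conn S \<longleftrightarrow> S \<noteq> {} \<and> (\<forall>A. A \<subseteq> S \<longrightarrow> A \<noteq> {} \<longrightarrow> separated A (S - A) \<longrightarrow> A = S)"

definition component :: "'a set \<Rightarrow> 'a set \<Rightarrow> bool" where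
  "component C S \<longleftrightarrow> C \<subseteq> S \<and> conn C \<and> separated C (S - C)"

text \<open>No \<open>K\<^bsub>1,k\<^esub>\<close> and no subgraph of minimum degree at least \<open>k - 1\<close>. Such a graph
  contains no regular graph of degree at least \<open>k - 1\<close>, and it is \<open>(k - 1)\<close>-colourable by
  degeneracy.\<close>
definition sparse :: "'a set \<Rightarrow> bool" where
  "sparse S \<longleftrightarrow> (\<forall>u\<in>S. card (nb S u) < k) \<and>
     (\<forall>T\<subseteq>S. T \<noteq> {} \<longrightarrow> (\<exists>u\<in>T. card (nb T u) + 1 < k))"

definition clique :: "'a set \<Rightarrow> bool" where
  "clique S \<longleftrightarrow> (\<forall>u\<in>S. \<forall>w\<in>S. u \<noteq> w \<longrightarrow> adj u w)"

definition cyc5 :: "'a \<Rightarrow> 'a \<Rightarrow> 'a \<Rightarrow> 'a \<Rightarrow> 'a \<Rightarrow> bool" where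
  "cyc5 a b c d e \<longleftrightarrow> distinct [a, b, c, d, e] \<and>
     adj a b \<and> adj b c \<and> adj c d \<and> adj d e \<and> adj e a \<and>
     \<not> adj a c \<and> \<not> adj a d \<and> \<not> adj b d \<and> \<not> adj b e \<and> \<not> adj c e"

definition pentagon :: "'a set \<Rightarrow> bool" where
  "pentagon S \<longleftrightarrow> (\<exists>a b c d e. S = {a, b, c, d, e} \<and> cyc5 a b c d e)"

definition exceptional :: "'a set \<Rightarrow> bool" where
  "exceptional S \<longleftrightarrow> (clique S \<and> card S = k) \<or> (k = 2 \<and> pentagon S)"

text \<open>The product form of the bound stands for the floor, and \<open>sparse\<close> stands for
  all four families, so one statement settles every \<open>i\<close>.\<close>

definition good :: "'a set \<Rightarrow> bool" where
  "good S \<longleftrightarrow> (\<exists>D\<subseteq>S. card D * (k + 1) \<le> card S \<and> sparse (S - nbhd D))"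

section \<open>Sparse vertex sets\<close>

lemma nb_mono: "T \<subseteq> S \<Longrightarrow> nb T u \<subseteq> nb S u"
  by (auto simp: nb_def)

lemma finite_nb: "finite S \<Longrightarrow> finite (nb S u)"
  by (simp add: nb_def)

lemma separated_sym: "separated A B \<Longrightarrow> separated B A"
  using adj_sym by (auto simp: separated_def)

lemma separated_mono: "separated A B \<Longrightarrow> A' \<subseteq> A \<Longrightarrow> separated A' B"
  unfolding separated_def by blast

lemma separated_trans:
  assumes "separated A (C - A)" "separated C (S - C)" "A \<subseteq> C"
  shows "separated A (S - A)"
  using assms unfolding separated_def by blast

lemma conn_edge:
  assumes "conn S" "A \<subseteq> S" "A \<noteq> {}" "A \<noteq> S"
  obtains a b where "a \<in> A" "b \<in> S - A" "adj a b"
  using assms unfolding conn_def separated_def by blast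

lemma sparse_mono:
  assumes "finite S" "sparse S" "T \<subseteq> S"
  shows "sparse T"
proof -
  have "card (nb T u) \<le> card (nb S u)" for u
    using assms by (intro card_mono finite_nb nb_mono)
  then show ?thesis
    using assms unfolding sparse_def by (meson le_less_trans subset_eq)
qed

text \<open>All neighbours of a vertex stay on its own side, so degrees within a subset can be
  computed in the part of it on that side.\<close>

lemma sparse_Un:
  assumes A: "sparse A" and B: "sparse B" and sep: "separated A B"
  shows "sparse (A \<union> B)"
proof -
  have *: "nb (T \<inter> (A \<union> B)) u = nb (T \<inter> A) u" if "u \<in> A" for T u
    using that sep by (auto simp: nb_def separated_def)
  have **: "nb (T \<inter> (A \<union> B)) u = nb (T \<inter> B) u" if "u \<in> B" for T u
    using that separated_sym[OF sep] by (auto simp: nb_def separated_def)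
  have "card (nb (A \<union> B) u) < k" if "u \<in> A \<union> B" for u
    using *[of u UNIV] **[of u UNIV] that A B by (auto simp: sparse_def)
  moreover have "\<exists>u\<in>T. card (nb T u) + 1 < k" if T: "T \<subseteq> A \<union> B" "T \<noteq> {}" for T
  proof -
    have eq: "T \<inter> (A \<union> B) = T" using T by blast
    show ?thesis
    proof (cases "T \<inter> A = {}")
      case False
      then obtain u where "u \<in> T \<inter> A" "card (nb (T \<inter> A) u) + 1 < k"
        using A unfolding sparse_def by (meson inf_le2)
      then show ?thesis using *[of u T] eq by (intro bexI[of _ u]) auto
    next
      case True
      then have "T \<inter> B \<noteq> {}" using T by blast
      then obtain u where "u \<in> T \<inter> B" "card (nb (T \<inter> B) u) + 1 < k"
        using B unfolding sparse_def by (meson inf_le2)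
      then show ?thesis using **[of u T] eq by (intro bexI[of _ u]) auto
    qed
  qed
  ultimately show ?thesis by (auto simp: sparse_def)
qed

lemma card_nb_less:
  assumes "finite T" "u \<in> T"
  shows "card (nb T u) + 1 \<le> card T"
proof -
  have "nb T u \<subseteq> T - {u}" using adj_irrefl by (auto simp: nb_def)
  then have "card (nb T u) \<le> card (T - {u})"
    using assms by (intro card_mono) auto
  then show ?thesis using assms by (simp add: card_Diff_singleton) (metis Suc_pred assms card_gt_0_iff empty_iff not_less_eq_eq)
qed

lemma sparse_small:
  assumes "finite S" "card S < k"
  shows "sparse S"
proof -
  have "card (nb T u) + 1 < k" if "T \<subseteq> S" "u \<in> T" for T u
    using card_nb_less[of T u] card_mono[of S T] assms that finite_subset[of T S] by linarith
  then show ?thesis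
    unfolding sparse_def by (metis add_lessD1 ex_in_conv order_refl)
qed

text \<open>Among sets of at most \<open>k\<close> vertices only the \<open>k\<close>-clique fails
  to be sparse: a missing edge lowers a degree to at most \<open>k - 2\<close>, and proper subsets
  have too few vertices.\<close>

lemma sparse_nonclique:
  assumes "finite S" "card S \<le> k" "u \<in> S" "w \<in> S" "u \<noteq> w" "\<not> adj u w"
  shows "sparse S"
proof -
  have deg: "card (nb T t) + 1 \<le> card T \<and> card T \<le> k" if "T \<subseteq> S" "t \<in> T" for T t
    using card_nb_less[of T t] card_mono[of S T] assms that finite_subset[of T S] by linarith
  have "nb S u \<subseteq> S - {u, w}" using assms adj_irrefl by (auto simp: nb_def)
  then have "card (nb S u) \<le> card (S - {u, w})" using assms by (intro card_mono) auto
  also have "\<dots> = card S - 2" using assms by (subst card_Diff_subset) auto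
  finally have u: "card (nb S u) \<le> card S - 2" .
  have "card {u, w} \<le> card S" using assms by (intro card_mono) auto
  then have "card (nb S u) + 1 < k" using u assms by simp
  moreover have "\<exists>t\<in>T. card (nb T t) + 1 < k" if T: "T \<subset> S" "T \<noteq> {}" for T
  proof -
    obtain t where "t \<in> T" using T by blast
    then show ?thesis
      using card_nb_less[of T t] psubset_card_mono[of S T] assms T finite_subset[of T S]
      by (intro bexI[of _ t]) auto
  qed
  ultimately have "\<exists>t\<in>T. card (nb T t) + 1 < k" if "T \<subseteq> S" "T \<noteq> {}" for T
    using that assms(3) by blast
  moreover have "card (nb S t) < k" if "t \<in> S" for t using deg[of S t] that by simp
  ultimately show ?thesis by (auto simp: sparse_def)
qed

lemma component_exists:
  assumes "finite S" "v \<in> S"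
  obtains C where "component C S" "v \<in> C"
proof -
  \<comment> \<open>A smallest set with this property is connected: if \<open>A\<close> were a
    proper separated part of it, then \<open>A\<close> or its complement would contain
    \<open>v\<close> and be smaller.\<close>
  define P where "P C \<longleftrightarrow> C \<subseteq> S \<and> v \<in> C \<and> separated C (S - C)" for C
  have "P S" using assms by (auto simp: P_def separated_def)
  then obtain C where C: "P C" "\<And>B. P B \<Longrightarrow> card C \<le> card B"
    using ex_has_least_nat[of P S card] by blast
  have fin: "finite C" using C assms by (auto simp: P_def intro: finite_subset)
  have "A = C" if A: "A \<subseteq> C" "A \<noteq> {}" "separated A (C - A)" for A
  proof (cases "v \<in> A")
    case True
    then have "P A" using A C separated_trans[OF A(3)] by (auto simp: P_def)
    then show ?thesis using C(2) A fin by (simp add: card_seteq)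
  next
    case False
    have "separated (C - A) (C - (C - A))"
      using A separated_sym[OF A(3)] by (simp add: double_diff)
    then have "P (C - A)" using False C separated_trans[of "C - A" C] by (auto simp: P_def)
    then have "C - A = C" using C(2) fin by (intro card_seteq) auto
    then show ?thesis using A by blast
  qed
  then have "conn C" using C by (auto simp: conn_def P_def)
  then show thesis using C that by (auto simp: component_def P_def)
qed

lemma component_Diff:
  assumes "component C S" "component B (S - C)"
  shows "component B S"
proof -
  have "separated (S - C) (S - (S - C))"
    using assms separated_sym by (auto simp: component_def double_diff)
  then show ?thesis using assms separated_trans[of B "S - C" S] by (auto simp: component_def)
qed

section \<open>Labelled 5-cycles\<close>

lemma cyc5_adj:
  assumes "cyc5 a b c d e"
  shows "adj b a" "adj c b" "adj d c" "adj e d" "adj a e"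
  using assms by (auto simp: cyc5_def intro: adj_sym)

lemma cyc5_rotate: "cyc5 a b c d e \<Longrightarrow> cyc5 b c d e a"
  using adj_sym unfolding cyc5_def by auto

lemma cyc5_reflect: "cyc5 a b c d e \<Longrightarrow> cyc5 b a e d c"
  using adj_sym unfolding cyc5_def by auto

lemma pentagon_at:
  assumes "pentagon S" "a \<in> S"
  obtains b c d e where "S = {a, b, c, d, e}" "cyc5 a b c d e"
proof -
  obtain p q r s t where S: "S = {p, q, r, s, t}" and c: "cyc5 p q r s t"
    using assms by (auto simp: pentagon_def)
  note r1 = cyc5_rotate[OF c]
  note r2 = cyc5_rotate[OF r1]
  note r3 = cyc5_rotate[OF r2]
  note r4 = cyc5_rotate[OF r3]
  from S assms(2) consider "a = p" | "a = q" | "a = r" | "a = s" | "a = t" by blast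
  then show thesis
    by cases (use that S c r1 r2 r3 r4 in blast)+
qed

lemma pentagon_at_edge:
  assumes "pentagon S" "a \<in> S" "b \<in> S" "adj a b"
  obtains c d e where "S = {a, b, c, d, e}" "cyc5 a b c d e"
proof -
  obtain p c d e where S: "S = {a, p, c, d, e}" and cy: "cyc5 a p c d e"
    using pentagon_at assms by metis
  have "b = p \<or> b = e" using S cy assms adj_irrefl by (auto simp: cyc5_def)
  then show thesis
  proof
    assume "b = e"
    moreover have "cyc5 a e d c p"
      using cyc5_rotate[OF cyc5_rotate[OF cyc5_rotate[OF cyc5_rotate[OF cyc5_reflect[OF cy]]]]]
        cyc5_rotate cyc5_reflect by blast
    ultimately show thesis using that S by blast
  qed (use that S cy in blast)
qed

text \<open>Meant for a 5-cycle whose vertex \<open>a\<close> is dominated from outside: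
  \<open>c\<close> covers \<open>b\<close>, \<open>c\<close> and \<open>d\<close>, so at most
  \<open>e\<close> is left.\<close>

lemma sparse_pentagon:
  assumes "k = 2" "cyc5 a b c d e"
  shows "sparse ({a, b, c, d, e} - {a} - nbhd {c})"
proof (rule sparse_small)
  have "{a, b, c, d, e} - {a} - nbhd {c} \<subseteq> {e}"
    using assms adj_sym by (auto simp: cyc5_def nbhd_def)
  then have "card ({a, b, c, d, e} - {a} - nbhd {c}) \<le> card {e}" by (intro card_mono) auto
  then show "card ({a, b, c, d, e} - {a} - nbhd {c}) < k" using assms by simp
qed auto

lemma card_cyc5: "cyc5 a b c d e \<Longrightarrow> card {a, b, c, d, e} = 5"
  by (auto simp: cyc5_def)

text \<open>An exceptional graph loses its defect as soon as one of its vertices is dominated from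
  outside; hence only exceptional components that avoid \<open>Z\<close> are an obstruction.\<close>
lemma good_relative:
  assumes "finite Y"
    and "\<And>C. component C Y \<Longrightarrow> \<not> exceptional C \<Longrightarrow> good C"
    and "\<And>C. component C Y \<Longrightarrow> exceptional C \<Longrightarrow> C \<inter> Z \<noteq> {}"
  shows "\<exists>D\<subseteq>Y. card D * (k + 1) \<le> card Y \<and> sparse (Y - Z - nbhd D)"
  using assms
proof (induction "card Y" arbitrary: Y rule: less_induct)
  case less
  show ?case
  proof (cases "Y = {}")
    case True
    then show ?thesis using k_pos by (auto intro: sparse_small)
  next
    case False
    then obtain C where C: "component C Y" using component_exists less.prems(1) by blast
    have CY: "C \<subseteq> Y" "C \<noteq> {}" "separated C (Y - C)" using C by (auto simp: component_def conn_def)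
    have finC: "finite C" using CY less.prems(1) finite_subset by blast
    have cardY: "card Y = card C + card (Y - C)"
      using CY finC less.prems(1) by (metis card_Diff_subset card_mono le_add_diff_inverse)
    have "card C > 0" using CY finC by (simp add: card_gt_0_iff)
    then have "\<exists>D\<subseteq>Y - C. card D * (k + 1) \<le> card (Y - C) \<and> sparse (Y - C - Z - nbhd D)"
      using less.prems cardY component_Diff[OF C] by (intro less.hyps) auto
    then obtain D1 where D1: "D1 \<subseteq> Y - C" "card D1 * (k + 1) \<le> card (Y - C)"
      "sparse (Y - C - Z - nbhd D1)" by blast
    have "\<exists>D\<subseteq>C. card D * (k + 1) \<le> card C \<and> sparse (C - Z - nbhd D)"
    proof (cases "exceptional C")
      case False
      then obtain D where "D \<subseteq> C" "card D * (k + 1) \<le> card C" "sparse (C - nbhd D)"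
        using less.prems(2) C by (auto simp: good_def)
      moreover have "C - Z - nbhd D \<subseteq> C - nbhd D" by blast
      ultimately show ?thesis using sparse_mono finC by (meson finite_Diff)
    next
      case True
      then obtain z where z: "z \<in> C" "z \<in> Z" using less.prems(3) C by blast
      show ?thesis
      proof (cases "card C = k")
        case True
        \<comment> \<open>Losing \<open>z\<close> leaves fewer than \<open>k\<close> vertices, so no
          dominating vertex is spent on this component.\<close>
        have "card (C - Z) < card C" using z finC by (intro psubset_card_mono) auto
        then have "sparse (C - Z - nbhd {})" using True finC by (intro sparse_small) (auto simp: nbhd_def)
        then show ?thesis by (intro exI[of _ "{}"]) auto
      next
        case False
        then have k2: "k = 2" and "pentagon C" using True by (auto simp: exceptional_def)
        then obtain b c d e where P: "C = {z, b, c, d, e}" "cyc5 z b c d e"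
          using pentagon_at z by metis
        have "C - Z - nbhd {c} \<subseteq> {z, b, c, d, e} - {z} - nbhd {c}" using P z by blast
        then have "sparse (C - Z - nbhd {c})"
          using sparse_pentagon[OF k2 P(2)] sparse_mono by (meson finite.emptyI finite.insertI finite_Diff)
        \<comment> \<open>One vertex is affordable, as the 5-cycle has more than
          \<open>k + 1 = 3\<close> vertices.\<close>
        then show ?thesis using P k2 card_cyc5[OF P(2)] by (intro exI[of _ "{c}"]) auto
      qed
    qed
    then obtain D2 where D2: "D2 \<subseteq> C" "card D2 * (k + 1) \<le> card C" "sparse (C - Z - nbhd D2)"
      by blast
    let ?A = "C - Z - nbhd D2" and ?B = "Y - C - Z - nbhd D1"
    have "sparse (?A \<union> ?B)"
      using D1 D2 CY by (intro sparse_Un) (auto simp: separated_def)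
    moreover have "Y - Z - nbhd (D2 \<union> D1) \<subseteq> ?A \<union> ?B" by (auto simp: nbhd_def)
    ultimately have "sparse (Y - Z - nbhd (D2 \<union> D1))"
      using sparse_mono finC less.prems(1) by (meson finite_Diff finite_UnI)
    moreover have "card (D2 \<union> D1) * (k + 1) \<le> card Y"
      using mult_le_mono1[OF card_Un_le[of D2 D1], of "k + 1"] D1 D2 cardY
      by (simp only: add_mult_distrib)
    ultimately show ?thesis using D1 D2 CY by (intro exI[of _ "D2 \<union> D1"]) auto
  qed
qed

end

section \<open>Minimal counterexamples\<close>

locale minimal_counterexample = isolation +
  fixes S :: "'a set"
  assumes finS: "finite S"
    and connS: "conn S"
    and not_exc: "\<not> exceptional S"
    and not_good: "\<not> good S"
    and minimal: "\<And>C. C \<subset> S \<Longrightarrow> conn C \<Longrightarrow> \<not> exceptional C \<Longrightarrow> good C"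
begin

text \<open>\<open>D0\<close> is paid for by \<open>X\<close>. If every exceptional component of
  \<open>S - X\<close> met \<open>nbhd D0\<close>, then \<open>good_relative\<close> with
  \<open>Z = nbhd D0\<close> would extend \<open>D0\<close> to a set showing that \<open>S\<close>
  is good.\<close>

lemma reduction:
  assumes X: "X \<subseteq> S" "X \<noteq> {}" and D0: "D0 \<subseteq> S" "card D0 * (k + 1) \<le> card X"
    and sp: "sparse (X - nbhd D0)" and sep: "separated (X - nbhd D0) (S - X)"
  obtains C where "component C (S - X)" "exceptional C" "C \<inter> nbhd D0 = {}"
proof (rule ccontr)
  assume neg: "\<not> thesis"
  note rule = that
  have exc: "C \<inter> nbhd D0 \<noteq> {}" if "component C (S - X)" "exceptional C" for C
    using that rule neg by blast
  have "\<exists>D\<subseteq>S - X. card D * (k + 1) \<le> card (S - X) \<and> sparse (S - X - nbhd D0 - nbhd D)"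
  proof (rule good_relative)
    show "good C" if "component C (S - X)" "\<not> exceptional C" for C
      using that X by (intro minimal) (auto simp: component_def)
  qed (use finS exc in auto)
  then obtain D where D: "D \<subseteq> S - X" "card D * (k + 1) \<le> card (S - X)"
    "sparse (S - X - nbhd D0 - nbhd D)" by blast
  let ?A = "X - nbhd D0" and ?B = "S - X - nbhd D0 - nbhd D"
  have "finite (?A \<union> ?B)" using X finS finite_subset by (metis finite_Diff finite_Un)
  moreover have "sparse (?A \<union> ?B)"
    using D sp sep by (intro sparse_Un) (auto simp: separated_def)
  moreover have "S - nbhd (D0 \<union> D) \<subseteq> ?A \<union> ?B" by (auto simp: nbhd_def)
  ultimately have "sparse (S - nbhd (D0 \<union> D))" using sparse_mono by blast
  moreover have "card S = card X + card (S - X)"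
    using X finS by (metis card_Diff_subset card_mono finite_subset le_add_diff_inverse)
  then have "card (D0 \<union> D) * (k + 1) \<le> card S"
    using mult_le_mono1[OF card_Un_le[of D0 D], of "k + 1"] D D0 by (simp only: add_mult_distrib)
  ultimately have "good S" using D D0 by (auto simp: good_def intro!: exI[of _ "D0 \<union> D"])
  then show False using not_good by blast
qed

lemma component_attached:
  assumes "X \<subseteq> S" "X \<noteq> {}" "component C (S - X)"
  obtains c x where "c \<in> C" "x \<in> X" "adj c x"
proof -
  have "C \<subseteq> S" "C \<noteq> {}" "C \<noteq> S" using assms by (auto simp: component_def conn_def)
  then obtain c x where "c \<in> C" "x \<in> S - C" "adj c x" using conn_edge connS by metis
  moreover from this have "x \<in> X" using assms by (auto simp: component_def separated_def)
  ultimately show thesis using that by blast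
qed

text \<open>Otherwise \<open>S\<close> is regular of degree \<open>k - 1\<close> and no nonempty
  proper subset has minimum degree \<open>k - 1\<close>, so removing the closed neighbourhood of any
  vertex leaves a sparse set.\<close>

lemma vertex_of_large_degree: "\<exists>v\<in>S. card (nb S v) \<ge> k"
proof (rule ccontr)
  assume "\<not> ?thesis"
  then have deg: "card (nb S u) < k" if "u \<in> S" for u using that by auto
  \<comment> \<open>With all degrees below \<open>k\<close>, every vertex of \<open>T\<close> has
    all its neighbours in \<open>T\<close>, and connectedness leaves nothing outside
    \<open>T\<close>.\<close>
  have all: "T = S \<and> (\<forall>u\<in>T. card (nb S u) + 1 = k)"
    if T: "T \<subseteq> S" "T \<noteq> {}" "\<And>u. u \<in> T \<Longrightarrow> \<not> card (nb T u) + 1 < k" for T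
  proof -
    have eq: "nb T u = nb S u" if "u \<in> T" for u
    proof (intro card_seteq finite_nb finS nb_mono)
      have "u \<in> S" using that T by blast
      then show "card (nb S u) \<le> card (nb T u)" using T(3)[OF that] deg[of u] by simp
    qed (rule T)
    have "separated T (S - T)"
    proof -
      have "w \<in> T" if "u \<in> T" "w \<in> S" "adj u w" for u w
        using eq[OF that(1)] that by (auto simp: nb_def)
      then show ?thesis by (auto simp: separated_def)
    qed
    then have "T = S" using T connS by (auto simp: conn_def)
    moreover have "card (nb S u) + 1 = k" if "u \<in> T" for u
      using T that deg[of u] eq[OF that] T(3)[OF that] by auto
    ultimately show ?thesis by blast
  qed
  \<comment> \<open>The empty set is always affordable, so \<open>S\<close> itself is not
    sparse.\<close>
  have "\<not> sparse (S - nbhd {})" using not_good by (auto simp: good_def)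
  then obtain T where T: "T \<subseteq> S" "T \<noteq> {}" "\<And>u. u \<in> T \<Longrightarrow> \<not> card (nb T u) + 1 < k"
    using deg by (auto simp: sparse_def nbhd_def)
  have reg: "card (nb S u) + 1 = k" if "u \<in> S" for u using all[OF T] that by blast
  obtain v where v: "v \<in> S" using T by blast
  have nonadj: "nb S u \<subseteq> S - {u}" for u using adj_irrefl by (auto simp: nb_def)
  have "card S \<ge> k" using reg[OF v] card_nb_less[OF finS v] by simp
  \<comment> \<open>With only \<open>k\<close> vertices the regular graph would be a
    \<open>k\<close>-clique, hence exceptional. So there are the \<open>k + 1\<close> vertices that
    pay for \<open>v\<close>.\<close>
  moreover have "card S \<noteq> k"
  proof
    assume c: "card S = k"
    have "nb S u = S - {u}" if "u \<in> S" for u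
      using nonadj that reg[OF that] c finS
      by (intro card_seteq) (auto simp: card_Diff_singleton)
    then have "clique S" by (auto simp: clique_def nb_def)
    then show False using c not_exc by (auto simp: exceptional_def)
  qed
  ultimately have card: "card {v} * (k + 1) \<le> card S" by simp
  have "sparse (S - nbhd {v})"
    unfolding sparse_def
  proof (intro conjI allI ballI impI)
    fix u assume u: "u \<in> S - nbhd {v}"
    have "card (nb (S - nbhd {v}) u) \<le> card (nb S u)"
      by (intro card_mono finite_nb finS nb_mono) auto
    then show "card (nb (S - nbhd {v}) u) < k" using deg[of u] u by auto
  next
    fix T assume T: "T \<subseteq> S - nbhd {v}" "T \<noteq> {}"
    then have "T \<noteq> S" using v by (auto simp: nbhd_def)
    then show "\<exists>u\<in>T. card (nb T u) + 1 < k" using all[of T] T by blast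
  qed
  then show False using card v not_good unfolding good_def by blast
qed

section \<open>Exceptional components outside the closed neighbourhood of a vertex of large
  degree\<close>

context
  fixes v
  assumes vS: "v \<in> S" and deg: "k \<le> card (nb S v)"
begin

definition pendant :: "'a set \<Rightarrow> bool" where
  "pendant H \<longleftrightarrow> component H (S - nbhd {v}) \<and> exceptional H"

lemma pendantD:
  assumes "pendant H"
  shows "H \<subseteq> S" "v \<notin> H" "H \<inter> nb S v = {}" "finite H" "H \<noteq> {}"
    and "h \<in> H \<Longrightarrow> w \<in> S \<Longrightarrow> adj h w \<Longrightarrow> w \<notin> H \<Longrightarrow> w \<in> nb S v"
proof -
  have c: "component H (S - nbhd {v})" using assms by (simp add: pendant_def)
  then have sub: "H \<subseteq> S - nbhd {v}" and "conn H" by (simp_all add: component_def)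
  then show "H \<noteq> {}" by (simp add: conn_def)
  show H: "H \<subseteq> S" "v \<notin> H" "H \<inter> nb S v = {}"
    using sub by (auto simp: nbhd_def nb_def)
  show "finite H" using H(1) finS by (rule finite_subset)
  assume w: "h \<in> H" "w \<in> S" "adj h w" "w \<notin> H"
  then have "w \<in> nbhd {v}" using c by (auto simp: component_def separated_def)
  moreover have "w \<noteq> v" using w adj_sym[of h w] H by (auto simp: nb_def)
  ultimately show "w \<in> nb S v" using w by (auto simp: nbhd_def nb_def)
qed

lemma pendant_exists: obtains H where "pendant H"
proof -
  \<comment> \<open>\<open>v\<close> dominates all of \<open>?X\<close>, which has at least
    \<open>k + 1\<close> vertices, so \<open>reduction\<close> applies with nothing left over in
    \<open>?X\<close>.\<close>
  let ?X = "insert v (nb S v)"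
  have eq: "?X - nbhd {v} = {}" "S - ?X = S - nbhd {v}" by (auto simp: nb_def nbhd_def)
  have "v \<notin> nb S v" using adj_irrefl by (simp add: nb_def)
  then have "card {v} * (k + 1) \<le> card ?X" using deg finite_nb[OF finS] by simp
  moreover have "?X \<subseteq> S" "?X \<noteq> {}" "{v} \<subseteq> S" using vS by (auto simp: nb_def)
  moreover have "sparse {}" using k_pos by (intro sparse_small) auto
  moreover have "separated {} (S - ?X)" by (simp add: separated_def)
  ultimately obtain C where "component C (S - ?X)" "exceptional C"
    using reduction[of ?X "{v}"] unfolding eq(1) by metis
  then have "pendant C" unfolding eq(2) by (simp add: pendant_def)
  then show thesis by (rule that)
qed

text \<open>If all links of \<open>H\<close> ended in a single \<open>x\<close>, then deleting
  \<open>H\<close> and \<open>x\<close> with \<open>x\<close> in \<open>D0\<close> would contradict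
  \<open>reduction\<close>, since every remaining component is attached at \<open>x\<close>. The
  ends \<open>y\<close> and \<open>y'\<close> may coincide.\<close>

lemma pendant_two_links:
  assumes H: "pendant H"
  obtains x x' y y' where "x \<in> nb S v" "x' \<in> nb S v" "x \<noteq> x'" "y \<in> H" "y' \<in> H"
    "adj y x" "adj y' x'"
proof (rule ccontr)
  assume neg: "\<not> thesis"
  note rule = that
  note HD = pendantD[OF H]
  have "H \<noteq> S" using HD vS by blast
  then obtain y x where yx: "y \<in> H" "x \<in> S - H" "adj y x"
    using conn_edge[OF connS HD(1,5)] by metis
  then have x: "x \<in> nb S v" using HD(6)[of y x] by simp
  have xy: "adj x y" using yx(3) by (rule adj_sym)
  have unique: "x' = x" if "x' \<in> nb S v" "y' \<in> H" "adj y' x'" for x' y'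
    using rule[of x x' y y'] neg that x yx by metis
  let ?X = "insert x H"
  \<comment> \<open>For a clique \<open>{x}\<close> works, paid for by \<open>k + 1\<close>
    vertices. For a 5-cycle a vertex at distance two from \<open>y\<close> is added: two vertices
    for six, with \<open>k + 1 = 3\<close>.\<close>
  have "\<exists>D0\<subseteq>?X. x \<in> D0 \<and> card D0 * (k + 1) \<le> card ?X \<and> sparse (?X - nbhd D0)"
  proof (cases "card H = k")
    case True
    have "?X - nbhd {x} \<subseteq> H - {y}" using xy by (auto simp: nbhd_def)
    moreover have "sparse (H - {y})"
      using True HD yx k_pos by (intro sparse_small) auto
    ultimately have "sparse (?X - nbhd {x})" using sparse_mono HD(4) by blast
    then show ?thesis using True HD yx by (intro exI[of _ "{x}"]) auto
  next
    case False
    then have k2: "k = 2" and "pentagon H" using H by (auto simp: pendant_def exceptional_def)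
    then obtain b c d e where P: "H = {y, b, c, d, e}" "cyc5 y b c d e"
      using pentagon_at yx by metis
    have "?X - nbhd {x, c} \<subseteq> {y, b, c, d, e} - {y} - nbhd {c}"
      unfolding P(1) using xy by (auto simp: nbhd_def)
    then have "sparse (?X - nbhd {x, c})"
      using sparse_pentagon[OF k2 P(2)] sparse_mono by (meson finite.emptyI finite.insertI finite_Diff)
    moreover have "card {x, c} * (k + 1) \<le> card ?X"
    proof -
      have "card ?X = Suc (card H)" using yx HD(4) by simp
      also have "card H = 5" using card_cyc5[OF P(2)] unfolding P(1) .
      finally show ?thesis using k2 by (simp add: card_insert_if)
    qed
    moreover have "{x, c} \<subseteq> ?X" "x \<in> {x, c}" unfolding P(1) by auto
    ultimately show ?thesis by blast
  qed
  then obtain D0 where D0: "D0 \<subseteq> ?X" "x \<in> D0" "card D0 * (k + 1) \<le> card ?X"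
    "sparse (?X - nbhd D0)" by blast
  have X: "?X \<subseteq> S" "?X \<noteq> {}" using yx HD by auto
  have link: "u = x" if "h \<in> H" "u \<in> S - H" "adj h u" for h u
    using HD(6)[of h u] unique[of u h] that by blast
  have "separated (?X - nbhd D0) (S - ?X)"
    using link D0(2) unfolding separated_def nbhd_def by blast
  then obtain C where C: "component C (S - ?X)" "C \<inter> nbhd D0 = {}"
    using reduction[OF X, of D0] D0 X(1) by (metis order_trans)
  then obtain c u where cu: "c \<in> C" "u \<in> ?X" "adj c u"
    using component_attached X by metis
  have "c \<in> S - ?X" using C cu by (auto simp: component_def)
  moreover have "u \<noteq> x" using cu C D0 adj_sym[OF cu(3)] by (auto simp: nbhd_def)
  ultimately show False using link[of u c] cu adj_sym[OF cu(3)] by auto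
qed

text \<open>Every pendant exceptional component other than \<open>H\<close> has a second link to \<open>N(v)\<close>, so it
  stays attached to \<open>v\<close> when \<open>x\<close> is deleted.\<close>
lemma obstruction:
  assumes H: "pendant H" and x: "x \<in> nb S v"
    and D0: "D0 \<subseteq> S" "card D0 * (k + 1) \<le> card (insert x H)"
    and sp: "sparse (insert x H - nbhd D0)"
    and sep: "separated (insert x H - nbhd D0) (S - insert x H)"
  obtains C where "component C (S - insert x H)" "exceptional C" "C \<inter> nbhd D0 = {}"
    "insert v (nb S v - {x}) \<subseteq> C"
proof -
  note HD = pendantD[OF H]
  have X: "insert x H \<subseteq> S" "x \<noteq> v" using x HD(1) adj_irrefl by (auto simp: nb_def)
  then obtain C where C: "component C (S - insert x H)" "exceptional C" "C \<inter> nbhd D0 = {}"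
    using reduction[OF X(1) _ D0 sp sep] by blast
  have closed: "w \<in> C" if "c \<in> C" "w \<in> S - insert x H" "adj c w" for c w
    using C that by (auto simp: component_def separated_def)
  have CX: "C \<subseteq> S - insert x H" using C by (simp add: component_def)
  \<comment> \<open>Otherwise \<open>C\<close> avoids N(v) and is pendant itself. One of its two
    links then ends in a vertex of N(v) other than \<open>x\<close>, which survives the deletion and
    so lies in \<open>C\<close>.\<close>
  have "v \<in> C"
  proof (rule ccontr)
    assume v: "v \<notin> C"
    have nbC: "w \<notin> C" if "w \<in> nb S v" for w
      using closed[of w v] that v vS X HD(2) adj_sym[of v w] by (auto simp: nb_def)
    have "C \<subseteq> S - nbhd {v}" using nbC v CX by (auto simp: nbhd_def nb_def)
    moreover have "separated C (S - nbhd {v} - C)"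
    proof -
      have False if cw: "c \<in> C" "w \<in> S - nbhd {v} - C" "adj c w" for c w
      proof (cases "w \<in> insert x H")
        case True
        then have "w \<in> H" using cw x by (auto simp: nb_def nbhd_def)
        then have "c \<in> nb S v" using HD(6)[of w c] cw CX adj_sym[of c w] by blast
        then show False using nbC cw by blast
      next
        case False
        then show False using closed cw by blast
      qed
      then show ?thesis by (auto simp: separated_def)
    qed
    ultimately have "pendant C" using C by (auto simp: pendant_def component_def)
    then obtain x1 x2 y1 y2 where "x1 \<in> nb S v" "x2 \<in> nb S v" "x1 \<noteq> x2" "y1 \<in> C" "y2 \<in> C"
      "adj y1 x1" "adj y2 x2" by (rule pendant_two_links)
    then obtain x' y' where l: "x' \<in> nb S v" "x' \<noteq> x" "y' \<in> C" "adj y' x'" by metis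
    then have "x' \<in> S - insert x H" using HD(3) by (auto simp: nb_def)
    then show False using closed[of y' x'] l nbC by blast
  qed
  moreover have "w \<in> C" if "w \<in> nb S v - {x}" for w
    using closed[of v w] \<open>v \<in> C\<close> that HD(3) by (auto simp: nb_def)
  ultimately have "insert v (nb S v - {x}) \<subseteq> C" by blast
  with C show thesis by (rule that)
qed

section \<open>Pendant 5-cycles are impossible\<close>

lemma card_pendant_pentagon:
  assumes "pendant H" "H = {y, a, b, c, d}" "cyc5 y a b c d" "x \<in> nb S v"
  shows "card (insert x H) = 6"
proof -
  have "x \<notin> H" using pendantD(3)[OF assms(1)] assms(4) by blast
  then have "card (insert x H) = Suc (card H)"
    using pendantD(4)[OF assms(1)] by (intro card_insert_disjoint) auto
  then show ?thesis using card_cyc5[OF assms(3)] assms(2) by (simp only:)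
qed

text \<open>\<open>{y, b}\<close> dominates both \<open>H\<close> and \<open>x\<close>, so the
  obstruction avoids \<open>nbhd {y, b}\<close>; yet it would contain \<open>x'\<close> if
  \<open>x'\<close> differed from \<open>x\<close>.\<close>

lemma pentagon_link_far:
  assumes H: "pendant H" and P: "H = {y, a, b, c, d}" and cy: "cyc5 y a b c d" and k2: "k = 2"
    and x: "x \<in> nb S v" "adj y x" and x': "x' \<in> nb S v" "adj y' x'" "y' \<in> {y, b}"
  shows "x' = x"
proof (rule ccontr)
  assume ne: "x' \<noteq> x"
  have "adj y a" "adj y d" "adj b c" using cy cyc5_adj[OF cy] by (simp_all add: cyc5_def)
  then have cover: "insert x H - nbhd {y, b} = {}"
    unfolding P using x(2) by (simp add: nbhd_def)
  have "sparse {}" using k2 by (intro sparse_small) auto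
  then have sp: "sparse (insert x H - nbhd {y, b})" by (simp only: cover)
  have sep: "separated (insert x H - nbhd {y, b}) (S - insert x H)"
    unfolding cover by (simp add: separated_def)
  have sub: "{y, b} \<subseteq> S" using P pendantD(1)[OF H] by blast
  have card: "card {y, b} * (k + 1) \<le> card (insert x H)"
    using k2 card_pendant_pentagon[OF H P cy x(1)] by (simp add: card_insert_if)
  obtain C where "C \<inter> nbhd {y, b} = {}" "insert v (nb S v - {x}) \<subseteq> C"
    by (rule obstruction[OF H x(1) sub card sp sep])
  then show False using x' ne by (auto simp: nbhd_def)
qed

text \<open>\<open>{x, b}\<close> dominates \<open>x\<close> and all of \<open>H\<close> except
  possibly \<open>d\<close>. If \<open>d\<close> had no link besides \<open>x\<close>, there would
  be an obstruction avoiding \<open>nbhd {x, b}\<close>; but it contains \<open>v\<close>, a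
  neighbour of \<open>x\<close>.\<close>

lemma pentagon_link_near:
  assumes H: "pendant H" and P: "H = {y, a, b, c, d}" and cy: "cyc5 y a b c d" and k2: "k = 2"
    and x: "x \<in> nb S v" "adj y x"
  obtains x' where "x' \<in> nb S v" "adj d x'" "x' \<noteq> x"
proof (rule ccontr)
  assume neg: "\<not> thesis"
  note rule = that
  have "adj x y" "adj b a" "adj b c"
    using cy cyc5_adj[OF cy] adj_sym[OF x(2)] by (simp_all add: cyc5_def)
  then have sub: "insert x H - nbhd {x, b} \<subseteq> {d}"
    unfolding P by (simp add: nbhd_def)
  have "sparse {d}" using k2 by (intro sparse_small) auto
  then have sp: "sparse (insert x H - nbhd {x, b})" using sparse_mono[OF _ _ sub] by simp
  have card: "card {x, b} * (k + 1) \<le> card (insert x H)"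
    using k2 card_pendant_pentagon[OF H P cy x(1)] by (simp add: card_insert_if)
  have xb: "{x, b} \<subseteq> S" using P pendantD(1)[OF H] x by (simp add: nb_def)
  have sep: "separated (insert x H - nbhd {x, b}) (S - insert x H)"
  proof -
    have "\<not> adj d w" if w: "w \<in> S - insert x H" for w
    proof
      assume dw: "adj d w"
      have "d \<in> H" using P by simp
      then have "w \<in> nb S v" using pendantD(6)[OF H, of d w] dw w by simp
      then have thesis using dw w by (intro rule[of w]) auto
      then show False using neg by contradiction
    qed
    then have "separated {d} (S - insert x H)" by (simp add: separated_def)
    then show ?thesis by (rule separated_mono[OF _ sub])
  qed
  obtain C where "C \<inter> nbhd {x, b} = {}" "insert v (nb S v - {x}) \<subseteq> C"
    by (rule obstruction[OF H x(1) xb card sp sep])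
  moreover have "adj x v" using x adj_sym[of v x] by (simp add: nb_def)
  ultimately show False by (auto simp: nbhd_def)
qed

text \<open>Links of adjacent vertices differ and links at distance two agree, which is impossible
  around an odd cycle.\<close>

lemma pendant_not_pentagon:
  assumes H: "pendant H" and k2: "k = 2"
  shows "\<not> pentagon H"
proof
  assume "pentagon H"
  obtain x y where x: "x \<in> nb S v" "y \<in> H" "adj y x" using pendant_two_links[OF H] by metis
  obtain a b c d where P: "H = {y, a, b, c, d}" and cy: "cyc5 y a b c d"
    using pentagon_at[OF \<open>pentagon H\<close> x(2)] by metis
  \<comment> \<open>Each relabelling starts at a vertex with a known link;
    \<open>pentagon_link_far\<close> then speaks of the third vertex and
    \<open>pentagon_link_near\<close> of the last.\<close>
  have cy1: "cyc5 y d c b a" and cy2: "cyc5 a y d c b" and cy3: "cyc5 d c b a y"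
    using cyc5_reflect[OF cy] cyc5_rotate cyc5_reflect cy by metis+
  have P1: "H = {y, d, c, b, a}" and P2: "H = {a, y, d, c, b}" and P3: "H = {d, c, b, a, y}"
    using P by auto
  obtain x2 where x2: "x2 \<in> nb S v" "adj d x2" "x2 \<noteq> x"
    using pentagon_link_near[OF H P cy k2 x(1,3)] by metis
  obtain x1 where x1: "x1 \<in> nb S v" "adj a x1" "x1 \<noteq> x"
    using pentagon_link_near[OF H P1 cy1 k2 x(1,3)] by metis
  have eq: "x2 = x1"
    using pentagon_link_far[OF H P2 cy2 k2 x1(1,2) x2(1,2)] by simp
  obtain w where w: "w \<in> nb S v" "adj b w" "w \<noteq> x1"
    using pentagon_link_near[OF H P2 cy2 k2 x1(1,2)] by metis
  have "w = x2"
    using pentagon_link_far[OF H P3 cy3 k2 x2(1,2) w(1,2)] by simp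
  then show False using w eq by simp
qed

section \<open>Pendant cliques are impossible\<close>

lemma clique_obstruction:
  assumes H: "pendant H" "clique H" "card H = k"
    and x: "x \<in> nb S v" and y: "y \<in> H" "adj y x"
  obtains C where "component C (S - insert x H)" "exceptional C" "C \<inter> nbhd {y} = {}"
    "insert v (nb S v - {x}) \<subseteq> C"
proof -
  note HD = pendantD[OF H(1)]
  \<comment> \<open>In a clique the linked vertex \<open>y\<close> alone dominates \<open>H\<close>
    and \<open>x\<close>, together \<open>k + 1\<close> vertices.\<close>
  have cover: "insert x H - nbhd {y} = {}" using H(2) x y by (auto simp: clique_def nbhd_def)
  have sep: "separated (insert x H - nbhd {y}) (S - insert x H)"
    unfolding cover by (simp add: separated_def)
  have "x \<notin> H" using HD(3) x by blast
  then have card: "card {y} * (k + 1) \<le> card (insert x H)" using H(3) HD(4) by simp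
  have sub: "{y} \<subseteq> S" using y HD(1) by blast
  have "sparse {}" using k_pos by (intro sparse_small) auto
  then have sp: "sparse (insert x H - nbhd {y})" by (simp only: cover)
  show thesis by (rule obstruction[OF H(1) x sub card sp sep]) (rule that)
qed

text \<open>The obstruction avoids \<open>nbhd {y}\<close> but contains every vertex of N(v) other
  than \<open>x\<close>, so \<open>y\<close> has no second link.\<close>

lemma clique_link_unique:
  assumes H: "pendant H" "clique H" "card H = k"
    and x: "x \<in> nb S v" and y: "y \<in> H" "adj y x" and x': "x' \<in> nb S v" "adj y x'"
  shows "x' = x"
proof (rule ccontr)
  assume "x' \<noteq> x"
  moreover obtain C where "C \<inter> nbhd {y} = {}" "insert v (nb S v - {x}) \<subseteq> C"
    using clique_obstruction[OF H x y] by metis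
  ultimately show False using x' by (auto simp: nbhd_def)
qed

text \<open>Otherwise the edge \<open>H\<close>, the vertex \<open>x\<close> and the 5-cycle
  \<open>C\<close> could be deleted together at the price of two vertices, the rest of
  \<open>S\<close> being attached through \<open>x\<close> alone.\<close>

lemma obstruction_not_pentagon:
  assumes H: "pendant H" "clique H" "card H = k" and k2: "k = 2"
    and x: "x \<in> nb S v" and y: "y \<in> H" "adj y x"
    and C: "component C (S - insert x H)" "insert v (nb S v - {x}) \<subseteq> C"
  shows "\<not> pentagon C"
proof
  assume "pentagon C"
  note HD = pendantD[OF H(1)]
  obtain x2 y2 where x2: "x2 \<in> nb S v" "x2 \<noteq> x" "y2 \<in> H" "adj y2 x2"
    using pendant_two_links[OF H(1)] by metis
  have ne: "y \<noteq> y2" using clique_link_unique[OF H x y x2(1)] x2 by blast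
  have "{y, y2} = H" using y x2 HD(4) ne H(3) k2 by (intro card_seteq) auto
  then have Heq: "H = {y, y2}" by simp
  have vx2: "adj v x2" using x2 by (simp add: nb_def)
  obtain p q z where P: "C = {v, x2, p, q, z}" and cy: "cyc5 v x2 p q z"
    using pentagon_at_edge[OF \<open>pentagon C\<close> _ _ vx2] C x2 by blast
  have CX: "C \<subseteq> S - insert x H" using C by (simp add: component_def)
  have closed: "w \<in> C" if "c \<in> C" "w \<in> S - insert x H" "adj c w" for c w
    using C that by (auto simp: component_def separated_def)
  \<comment> \<open>\<open>{x, p}\<close> dominates the 8 vertices of \<open>H\<close>, \<open>x\<close> and the pentagon, except for the
    nonadjacent vertices \<open>y2\<close> and \<open>z\<close>.\<close>
  let ?X = "insert x H \<union> C"
  have X: "?X \<subseteq> S" using CX HD(1) x by (auto simp: nb_def)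
  have nbX: "nb S v \<subseteq> ?X" using C by blast
  have xH: "x \<notin> H" using x HD(3) by blast
  have "card ?X = card (insert x H) + card C"
    using CX HD(4) finS by (intro card_Un_disjoint) (auto intro: finite_subset)
  then have cardX: "card ?X = 8" using H(3) k2 xH HD(4) card_cyc5[OF cy] P by simp
  have xv: "adj x v" and xy: "adj x y" using x y adj_sym[of v x] adj_sym[of y x] by (auto simp: nb_def)
  have "adj p x2" "adj p q" using cy cyc5_adj[OF cy] by (simp_all add: cyc5_def)
  then have sub: "?X - nbhd {x, p} \<subseteq> {y2, z}"
    unfolding P Heq using xv xy by (auto simp: nbhd_def)
  \<comment> \<open>\<open>z\<close> lies in N(v) and is not \<open>x2\<close>, while
    \<open>x2\<close> is the only link of \<open>y2\<close>.\<close>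
  have "z \<in> nb S v" using cyc5_adj[OF cy] CX P by (auto simp: nb_def)
  moreover have "z \<noteq> x2" using cy by (auto simp: cyc5_def)
  ultimately have "\<not> adj y2 z" using clique_link_unique[OF H x2(1,3,4)] by blast
  moreover have "z \<noteq> y2" using x2 P CX by blast
  ultimately have "sparse {y2, z}"
    using k2 by (intro sparse_nonclique[of _ y2 z]) (auto simp: card_insert_if)
  then have sp: "sparse (?X - nbhd {x, p})" using sparse_mono[OF _ _ sub] by simp
  have y2: "w \<in> ?X" if "h \<in> H" "w \<in> S" "adj h w" for h w
    using HD(6)[of h w] that nbX by blast
  have z: "w \<in> ?X" if "c \<in> C" "w \<in> S" "adj c w" for c w
    using closed[of c w] that by blast
  have "separated (?X - nbhd {x, p}) (S - ?X)"
  proof -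
    have "w \<in> ?X" if "u \<in> {y2, z}" "w \<in> S" "adj u w" for u w
      using that y2[of u w] z[of u w] x2(3) P by blast
    then have "separated {y2, z} (S - ?X)" unfolding separated_def by blast
    then show ?thesis by (rule separated_mono[OF _ sub])
  qed
  moreover have "card {x, p} * (k + 1) \<le> card ?X" using cardX k2 by (simp add: card_insert_if)
  moreover have "{x, p} \<subseteq> S" "?X \<noteq> {}" using X P by auto
  ultimately obtain B where B: "component B (S - ?X)" "B \<inter> nbhd {x, p} = {}"
    using reduction[OF X, of "{x, p}"] sp by metis
  then obtain b u where bu: "b \<in> B" "u \<in> ?X" "adj b u"
    using component_attached[OF X _ B(1)] by blast
  have "b \<in> S - ?X" using B bu by (auto simp: component_def)
  \<comment> \<open>All neighbours of \<open>H\<close> and of \<open>C\<close> lie in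
    \<open>?X\<close>, so only \<open>x\<close> can be an attachment; but \<open>x\<close> is a
    dominating vertex.\<close>
  then have "u = x" using bu y2[of u b] z[of u b] adj_sym[OF bu(3)] by blast
  then show False using B bu adj_sym[OF bu(3)] by (auto simp: nbhd_def)
qed

text \<open>The obstruction is a \<open>k\<close>-clique, and it contains this set, whose size is
  the degree of \<open>v\<close>, at least \<open>k\<close>. So the two coincide, and
  \<open>v\<close> has degree exactly \<open>k\<close>.\<close>

lemma clique_link:
  assumes H: "pendant H" "clique H" "card H = k"
    and x: "x \<in> nb S v" and y: "y \<in> H" "adj y x"
  shows "component (insert v (nb S v - {x})) (S - insert x H)"
    and "clique (insert v (nb S v - {x}))"
    and "card (insert v (nb S v - {x})) = k"
proof -
  let ?W = "insert v (nb S v - {x})"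
  obtain C where C: "component C (S - insert x H)" "exceptional C" "?W \<subseteq> C"
    using clique_obstruction[OF H x y] by metis
  have cC: "clique C" "card C = k"
    using C obstruction_not_pentagon[OF H _ x y C(1,3)] by (auto simp: exceptional_def)
  have "v \<notin> nb S v" using adj_irrefl by (simp add: nb_def)
  then have "card ?W = card (nb S v)" using x finite_nb[OF finS]
    by (simp add: card_Diff_singleton card_gt_0_iff Suc_diff_1 ex_in_conv[symmetric])
      (metis Suc_pred card_gt_0_iff empty_iff)
  moreover have "finite C" using cC k_pos by (intro card_ge_0_finite) simp
  ultimately have "?W = C" using C cC deg by (intro card_seteq) auto
  then show "component ?W (S - insert x H)" "clique ?W" "card ?W = k" using C cC by auto
qed

text \<open>Tests the single vertex \<open>x'\<close>: it dominates the clique N[v] without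
  \<open>x\<close>, and \<open>y'\<close>, so at most the \<open>k\<close> vertices of
  \<open>insert x (H - {y'})\<close> remain. As \<open>S\<close> is not good, all of them remain and
  form a \<open>k\<close>-clique.\<close>

lemma clique_link_extends:
  assumes H: "pendant H" "clique H" "card H = k"
    and S: "S \<subseteq> insert v (nb S v) \<union> H"
    and x: "x \<in> nb S v" "y \<in> H" "adj y x" and x': "x' \<in> nb S v" "y' \<in> H" "adj y' x'"
    and ne: "x \<noteq> x'"
  shows "\<not> adj x' x" and "h \<in> H - {y'} \<Longrightarrow> adj x h"
proof -
  note HD = pendantD[OF H(1)]
  have xS: "x \<in> S" "x' \<in> S" using x x' by (auto simp: nb_def)
  have "clique (insert v (nb S v - {x}))" using clique_link(2)[OF H x] .
  then have "insert v (nb S v - {x}) \<subseteq> nbhd {x'}"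
    using x' ne by (auto simp: clique_def nbhd_def)
  moreover have "y' \<in> nbhd {x'}" using adj_sym[OF x'(3)] by (auto simp: nbhd_def)
  ultimately have sub: "S - nbhd {x'} \<subseteq> insert x (H - {y'}) - nbhd {x'}" using S by blast
  have Hy': "card (H - {y'}) < k" using HD(4) x' H(3) k_pos by simp
  have "k + 1 \<le> card S"
  proof -
    have "v \<notin> nb S v" using adj_irrefl by (simp add: nb_def)
    then have "k + 1 \<le> card (insert v (nb S v))" using deg finite_nb[OF finS] by simp
    also have "\<dots> \<le> card S" using vS finS by (intro card_mono) (auto simp: nb_def)
    finally show ?thesis .
  qed
  then have nsp: "\<not> sparse (S - nbhd {x'})" using not_good xS unfolding good_def by auto
  show na: "\<not> adj x' x"
  proof
    assume "adj x' x"
    then have "S - nbhd {x'} \<subseteq> H - {y'}" using sub by (auto simp: nbhd_def)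
    then show False using nsp sparse_mono sparse_small[OF _ Hy'] HD(4) by blast
  qed
  assume h: "h \<in> H - {y'}"
  show "adj x h"
  proof (rule ccontr)
    assume "\<not> adj x h"
    moreover have "x \<noteq> h" using h x HD(3) by blast
    moreover have "card (insert x (H - {y'})) \<le> k"
      using Hy' card_insert_le_m1[of k "H - {y'}" x] k_pos by simp
    ultimately have "sparse (insert x (H - {y'}))"
      using h HD(4) by (intro sparse_nonclique[of _ x h]) auto
    then show False using nsp sparse_mono sub HD(4) by (meson Diff_subset finite_Diff finite_insert order_trans)
  qed
qed

lemma pendant_not_clique:
  assumes H: "pendant H"
  shows "\<not> (clique H \<and> card H = k)"
proof
  assume c: "clique H \<and> card H = k"
  note HK = H c[THEN conjunct1] c[THEN conjunct2]
  note HD = pendantD[OF H]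
  obtain x x' y y' where x: "x \<in> nb S v" "y \<in> H" "adj y x"
    and x': "x' \<in> nb S v" "y' \<in> H" "adj y' x'" and ne: "x \<noteq> x'"
    using pendant_two_links[OF H] by metis
  \<comment> \<open>By \<open>clique_link\<close>, N[v] without a link \<open>t\<close> is a
    component once \<open>t\<close> and \<open>H\<close> are deleted. Every vertex of N(v) differs
    from \<open>x\<close> or from \<open>x'\<close>, so none has a neighbour beyond N[v] and
    \<open>H\<close>.\<close>
  have leave: "w \<in> insert v (nb S v) \<union> H"
    if u: "u \<in> nb S v" "u \<noteq> t" "w \<in> S" "adj u w"
      and t: "t \<in> nb S v" "s \<in> H" "adj s t" for t s u w
    using clique_link(1)[OF HK t] u t by (auto simp: component_def separated_def)
  have "insert v (nb S v) \<union> H = S"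
  proof (rule ccontr)
    assume "insert v (nb S v) \<union> H \<noteq> S"
    moreover have "insert v (nb S v) \<union> H \<subseteq> S" using vS HD(1) by (auto simp: nb_def)
    ultimately obtain u w where uw: "u \<in> insert v (nb S v) \<union> H"
      "w \<in> S - (insert v (nb S v) \<union> H)" "adj u w"
      using conn_edge[OF connS] by (metis Un_insert_left insert_not_empty)
    then consider "u = v" | "u \<in> nb S v" | "u \<in> H" by blast
    then show False
    proof cases
      case 1
      then show ?thesis using uw by (auto simp: nb_def)
    next
      case 2
      then show ?thesis using leave[of u x w y] leave[of u x' w y'] x x' ne uw by blast
    next
      case 3
      then show ?thesis using HD(6)[of u w] uw by blast
    qed
  qed
  then have S: "S \<subseteq> insert v (nb S v) \<union> H" by simp
  note ext = clique_link_extends[OF HK S x x' ne]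
  note ext' = clique_link_extends[OF HK S x' x ne[symmetric]]
  \<comment> \<open>A third vertex of \<open>H\<close> would be linked to both \<open>x\<close> and
    \<open>x'\<close>.\<close>
  have "h \<in> {y, y'}" if "h \<in> H" for h
    using ext(2)[of h] ext'(2)[of h] clique_link_unique[OF HK x(1) that _ x'(1)] that ne
      adj_sym[of x h] adj_sym[of x' h] by blast
  then have Heq: "H = {y, y'}" using x x' by blast
  have yy': "y \<noteq> y'" using clique_link_unique[OF HK x x'(1)] x' ne by blast
  then have k2: "k = 2" using HK(3) Heq by simp
  \<comment> \<open>N[v] without \<open>x\<close> has \<open>k = 2\<close> elements, so
    \<open>S\<close> has just five vertices.\<close>
  have "{v, x'} = insert v (nb S v - {x})"
  proof (rule card_seteq)
    show "{v, x'} \<subseteq> insert v (nb S v - {x})" using x' ne by blast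
    have "v \<noteq> x'" using x'(1) adj_irrefl by (auto simp: nb_def)
    then show "card (insert v (nb S v - {x})) \<le> card {v, x'}"
      using clique_link(3)[OF HK x] k2 by simp
  qed (simp add: finite_nb[OF finS])
  then have "S = {v, x, y, y', x'}" using S Heq x vS HD(1) x' by (auto simp: nb_def)
  moreover have "cyc5 v x y y' x'"
  proof -
    have "\<not> adj v y" "\<not> adj v y'" using HD(1,3) Heq by (auto simp: nb_def)
    moreover have "\<not> adj x y'" "\<not> adj y x'"
      using clique_link_unique[OF HK x x'(1)] clique_link_unique[OF HK x' x(1)] ne
        adj_sym[of x y'] by blast+
    moreover have "\<not> adj x x'" using ext(1) adj_sym[of x x'] by blast
    moreover have "adj v x" "adj x y" "adj y y'" "adj y' x'" "adj x' v"
      using x x' adj_sym[of y x] adj_sym[of v x'] HK(2) Heq yy' by (auto simp: nb_def clique_def)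
    moreover have "distinct [v, x, y, y', x']"
      using x x' ne yy' HD(2,3) Heq adj_irrefl by (auto simp: nb_def)
    ultimately show ?thesis by (simp add: cyc5_def)
  qed
  ultimately have "pentagon S" unfolding pentagon_def by blast
  then show False using k2 not_exc unfolding exceptional_def by blast
qed

lemma contradiction_at: False
  using pendant_exists pendant_not_clique pendant_not_pentagon
  by (metis pendant_def exceptional_def)

end

lemma contradiction: False
  using vertex_of_large_degree contradiction_at by blast

end

lemma (in isolation) good_of_connected:
  assumes "finite S" "conn S" "\<not> exceptional S"
  shows "good S"
  using assms
proof (induction "card S" arbitrary: S rule: less_induct)
  case less
  show ?case
  proof (rule ccontr)
    assume "\<not> good S"
    then have "minimal_counterexample adj k S"
      using less finite_subset[of _ S] psubset_card_mono[of S] by unfold_locales auto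
    then show False by (rule minimal_counterexample.contradiction)
  qed
qed

section \<open>Transfer to graphs given by edge sets\<close>

locale graph_isolation =
  fixes V :: "'a set" and E :: "'a set set" and k :: nat
  assumes wf: "wf_graph (V, E)" and k_ge_1: "k \<ge> 1"
begin

lemma edgeD: "{u, w} \<in> E \<Longrightarrow> u \<in> V \<and> w \<in> V \<and> u \<noteq> w"
  using wf unfolding wf_graph_def by (auto simp: doubleton_eq_iff)

lemma finite_V: "finite V"
  using wf by (simp add: wf_graph_def)

end

sublocale graph_isolation \<subseteq> isolation "\<lambda>u w. {u, w} \<in> E" k
proof unfold_locales
  show "{w, u} \<in> E" if "{u, w} \<in> E" for u w using that by (simp add: insert_commute)
  show "{u, u} \<notin> E" for u using edgeD[of u u] by blast
qed (rule k_ge_1)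

context graph_isolation
begin

lemma conn_V:
  assumes "connected_graph (V, E)"
  shows "conn V"
  unfolding conn_def
proof (intro conjI allI impI)
  show "V \<noteq> {}" using assms by (simp add: connected_graph_def)
  fix A assume A: "A \<subseteq> V" "A \<noteq> {}" "separated A (V - A)"
  then obtain a where a: "a \<in> A" by blast
  have "w \<in> A" if "(a, w) \<in> {(x, y). {x, y} \<in> E}\<^sup>*" for w
    using that
  proof (induction rule: rtrancl_induct)
    case (step y z)
    then show ?case using A edgeD[of y z] by (auto simp: separated_def)
  qed (rule a)
  then show "A = V" using assms A a by (auto simp: connected_graph_def)
qed

lemma special_if_exceptional:
  assumes "exceptional V"
  shows "special (V, E) k"
proof (cases "clique V \<and> card V = k")
  case True
  then obtain f where f: "bij_betw f V {0..<k}"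
    using ex_bij_betw_finite_nat[OF finite_V] by auto
  have "{u, w} \<in> E \<longleftrightarrow> {f u, f w} \<in> {{i, j} |i j. i < k \<and> j < k \<and> i \<noteq> j}"
    if "u \<in> V" "w \<in> V" for u w
  proof -
    have "f u < k" "f w < k" using f that by (auto simp: bij_betw_def)
    moreover have "f u = f w \<longleftrightarrow> u = w" using f that by (auto simp: bij_betw_def inj_on_def)
    moreover have "{u, w} \<in> E \<longleftrightarrow> u \<noteq> w" using True that edgeD[of u w] by (auto simp: clique_def)
    ultimately show ?thesis by (auto simp: doubleton_eq_iff)
  qed
  then show ?thesis using f by (auto simp: special_def graph_iso_def complete_graph_def)
next
  case False
  then have k2: "k = 2" and "pentagon V" using assms by (auto simp: exceptional_def)
  then obtain a b c d e where V: "V = {a, b, c, d, e}" and cy: "cyc5 a b c d e"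
    by (auto simp: pentagon_def)
  \<comment> \<open>The default 0 is the label of \<open>a\<close>.\<close>
  define f where "f = (\<lambda>_. 0 :: nat)(b := 1, c := 2, d := 3, e := 4)"
  have ne: "a \<noteq> b" "a \<noteq> c" "a \<noteq> d" "a \<noteq> e" "b \<noteq> c" "b \<noteq> d" "b \<noteq> e" "c \<noteq> d" "c \<noteq> e" "d \<noteq> e"
    using cy by (auto simp: cyc5_def)
  have f: "f a = 0" "f b = 1" "f c = 2" "f d = 3" "f e = 4"
    using ne by (simp_all add: f_def)
  have five: "{0..<5} = {0, 1, 2, 3, 4::nat}" by auto
  have edges: "snd cycle5 = {{0, 1}, {1, 2}, {2, 3}, {3, 4}, {4, 0}}"
  proof -
    have "snd cycle5 = (\<lambda>i. {i, (i + 1) mod 5}) ` {0..<5}" by (auto simp: cycle5_def)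
    then show ?thesis unfolding five by (simp add: numeral_2_eq_2)
  qed
  have nonadj: "{a, c} \<notin> E" "{a, d} \<notin> E" "{b, d} \<notin> E" "{b, e} \<notin> E" "{c, e} \<notin> E"
    "{c, a} \<notin> E" "{d, a} \<notin> E" "{d, b} \<notin> E" "{e, b} \<notin> E" "{e, c} \<notin> E"
    "{u} \<notin> E" for u
    using cy adj_irrefl[of u] by (simp_all add: cyc5_def insert_commute)
  have adj: "{a, b} \<in> E" "{b, c} \<in> E" "{c, d} \<in> E" "{d, e} \<in> E" "{e, a} \<in> E"
    "{b, a} \<in> E" "{c, b} \<in> E" "{d, c} \<in> E" "{e, d} \<in> E" "{a, e} \<in> E"
    using cy by (simp_all add: cyc5_def insert_commute)
  have "bij_betw f V (fst cycle5)"
    unfolding bij_betw_def V cycle5_def using ne by (simp add: f five)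
  moreover have "\<forall>u\<in>V. \<forall>w\<in>V. {u, w} \<in> E \<longleftrightarrow> {f u, f w} \<in> snd cycle5"
    unfolding V edges by (simp add: f adj nonadj doubleton_eq_iff)
  ultimately show ?thesis using k2 by (auto simp: special_def graph_iso_def)
qed

section \<open>Sparse sets contain no member of the families\<close>

lemma sparse_colouring:
  assumes "finite T" "sparse T"
  shows "\<exists>f. proper_colouring (T, E) (k - 1) f"
  using assms
proof (induction T rule: finite_psubset_induct)
  case (psubset T)
  show ?case
  proof (cases "T = {}")
    case True
    then show ?thesis by (simp add: proper_colouring_def)
  next
    case False
    \<comment> \<open>Greedy colouring: \<open>u\<close> is coloured last, and its fewer than
      \<open>k - 1\<close> neighbours leave one of the \<open>k - 1\<close> colours free.\<close>
    then obtain u where u: "u \<in> T" "card (nb T u) + 1 < k"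
      using psubset.prems by (auto simp: sparse_def)
    have "sparse (T - {u})" by (rule sparse_mono[OF psubset.hyps psubset.prems]) blast
    then obtain f where f: "proper_colouring (T - {u}, E) (k - 1) f"
      using psubset.IH[of "T - {u}"] u by blast
    have "card (f ` nb T u) \<le> card (nb T u)"
      using psubset.hyps by (intro card_image_le finite_nb)
    then have "card (f ` nb T u) < card {..<k - 1}" using u by simp
    then have "\<not> {..<k - 1} \<subseteq> f ` nb T u"
      using finite_nb[OF psubset.hyps] card_mono[of "f ` nb T u" "{..<k - 1}"] by auto
    then obtain c where c: "c < k - 1" "c \<notin> f ` nb T u" by auto
    have "proper_colouring (T, E) (k - 1) (f(u := c))"
      using f c edgeD by (auto simp: proper_colouring_def nb_def insert_commute)
    then show ?thesis by blast
  qed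
qed

text \<open>\<open>H\<close> need not be induced, but dropping edges only lowers degrees and keeps
  colourings proper. Thus a star centre lacks neighbours, some degree falls below
  \<open>k - 1\<close>, and \<open>k - 1\<close> colours suffice.\<close>

lemma sparse_not_fam:
  assumes W: "finite W" "sparse W" and H: "wf_graph H" "fst H \<subseteq> W" "snd H \<subseteq> E"
  shows "\<not> fam i k H"
proof -
  have "\<not> fam0 k H"
  proof
    assume "fam0 k H"
    then obtain f where f: "bij_betw f (fst H) (fst (star_graph k))"
      and e: "\<And>u w. u \<in> fst H \<Longrightarrow> w \<in> fst H \<Longrightarrow>
        {u, w} \<in> snd H \<longleftrightarrow> {f u, f w} \<in> snd (star_graph k)"
      unfolding fam0_def graph_iso_def by blast
    have star: "fst (star_graph k) = {0..k}" by (simp add: star_graph_def)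
    note f = f[unfolded star]
    have "0 \<in> f ` fst H" using f by (simp add: bij_betw_def)
    then obtain c where c: "c \<in> fst H" "f c = 0" by auto
    have "u \<in> nb W c" if u: "u \<in> fst H - {c}" for u
    proof -
      have "f u \<in> {0..k}" using bij_betwE[OF f] u by blast
      moreover have "f u \<noteq> 0" using f u c by (metis DiffE bij_betw_def inj_onD singletonI)
      ultimately have "{0, f u} \<in> snd (star_graph k)" by (auto simp: star_graph_def)
      then have "{c, u} \<in> snd H" using e[of c u] u c by simp
      then show ?thesis using H u by (auto simp: nb_def)
    qed
    then have "card (fst H - {c}) \<le> card (nb W c)" by (intro card_mono finite_nb W) auto
    moreover have "card (fst H) = k + 1" using bij_betw_same_card[OF f] by simp
    moreover have "card (nb W c) < k" using c H W by (auto simp: sparse_def)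
    ultimately show False using c by (simp add: card_Diff_singleton)
  qed
  moreover have "\<not> fam1 k H"
  proof
    assume "fam1 k H"
    then obtain d where d: "fst H \<noteq> {}" "d \<ge> k - 1" "\<And>u. u \<in> fst H \<Longrightarrow> degree H u = d"
      by (auto simp: fam1_def)
    obtain u where u: "u \<in> fst H" "card (nb (fst H) u) + 1 < k"
      using W(2) H(2) d(1) unfolding sparse_def by meson
    have "{w \<in> fst H. {w, u} \<in> snd H} \<subseteq> nb (fst H) u"
      using H(3) by (auto simp: nb_def insert_commute)
    then have "degree H u \<le> card (nb (fst H) u)"
      unfolding degree_def using finite_subset[OF H(2) W(1)] by (intro card_mono finite_nb)
    then show False using d(2) d(3)[OF u(1)] u(2) by simp
  qed
  moreover have "\<not> fam2 k H"
  proof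
    assume "fam2 k H"
    then have k: "fst H \<noteq> {}" "k \<le> chromatic_number H" by (auto simp: fam2_def)
    obtain f where "proper_colouring (fst H, E) (k - 1) f"
      using sparse_colouring[of "fst H"] sparse_mono[OF W H(2)] finite_subset[OF H(2) W(1)] by blast
    then have "proper_colouring H (k - 1) f" using H(3) by (auto simp: proper_colouring_def)
    then have "chromatic_number H \<le> k - 1" unfolding chromatic_number_def by (auto intro: Least_le)
    \<comment> \<open>\<open>k_pos\<close> guarantees that the truncated difference
      \<open>k - 1\<close> is below \<open>k\<close>.\<close>
    then show False using k k_pos by simp
  qed
  ultimately show ?thesis by (simp add: fam_def)
qed

lemma closed_nbhd_Diff: "D \<subseteq> V \<Longrightarrow> V - closed_nbhd (V, E) D = V - nbhd D"
  by (auto simp: closed_nbhd_def nbhd_def)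

lemma isolating_if_sparse:
  assumes "D \<subseteq> V" "sparse (V - nbhd D)"
  shows "isolating (V, E) (fam i k) D"
proof -
  have "\<not> fam i k H" if "subgraph H (delete_vertices (V, E) (closed_nbhd (V, E) D))" for H
  proof (rule sparse_not_fam)
    show "finite (V - nbhd D)" using finite_V by simp
    show "wf_graph H" "fst H \<subseteq> V - nbhd D" "snd H \<subseteq> E"
      using that closed_nbhd_Diff[OF assms(1)] by (auto simp: subgraph_def delete_vertices_def)
  qed (rule assms)
  then show ?thesis using assms by (auto simp: isolating_def)
qed

section \<open>Lower bound for \<open>B_graph\<close>\<close>

lemma clique_in_fam:
  assumes K: "finite K" "clique K" "card K = k" and i: "i \<in> {1, 2, 3}"
  obtains H where "wf_graph H" "fst H = K" "snd H \<subseteq> E" "\<Union>(snd H) \<subseteq> K" "fam i k H"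
proof -
  \<comment> \<open>The complete graph on \<open>K\<close> is regular of degree
    \<open>k - 1\<close>, and its proper colourings are injective. The star has \<open>k + 1\<close>
    vertices and does not fit, hence the range of \<open>i\<close>.\<close>
  define H where "H = (K, {{u, w} |u w. u \<in> K \<and> w \<in> K \<and> u \<noteq> w})"
  have fstH: "fst H = K" and edge: "{u, w} \<in> snd H \<longleftrightarrow> u \<in> K \<and> w \<in> K \<and> u \<noteq> w" for u w
    by (auto simp: H_def doubleton_eq_iff)
  have ne: "K \<noteq> {}" using K k_pos by auto
  have "degree H u = k - 1" if "u \<in> K" for u
  proof -
    have "{w \<in> fst H. {w, u} \<in> snd H} = K - {u}"
      unfolding edge fstH using that by blast
    then show ?thesis using that K by (simp add: degree_def card_Diff_singleton)
  qed
  then have 1: "fam1 k H" unfolding fam1_def fstH using ne by blast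
  have colouring: "proper_colouring H c f \<longleftrightarrow> f ` K \<subseteq> {..<c} \<and> inj_on f K" for c f
    unfolding proper_colouring_def edge fstH inj_on_def by blast
  \<comment> \<open>The minimum in \<open>chromatic_number\<close> is attained once some colouring
    exists; numbering the vertices provides one.\<close>
  obtain g where "bij_betw g K {0..<card K}" using ex_bij_betw_finite_nat[OF K(1)] by blast
  then have "proper_colouring H (card K) g"
    unfolding colouring by (simp add: bij_betw_def lessThan_atLeast0)
  then have "\<exists>f. proper_colouring H (card K) f" by (rule exI[of _ g])
  then have "\<exists>f. proper_colouring H (chromatic_number H) f"
    unfolding chromatic_number_def by (rule LeastI)
  then obtain f where "f ` K \<subseteq> {..<chromatic_number H}" "inj_on f K"
    unfolding colouring by blast
  then have "card K \<le> card {..<chromatic_number H}" by (intro card_inj_on_le) auto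
  then have "fam2 k H" using ne K by (simp add: fam2_def fstH)
  then have "fam i k H" using 1 i by (auto simp: fam_def)
  moreover have "wf_graph H" unfolding H_def wf_graph_def using K(1) by simp
  moreover have "snd H \<subseteq> E"
    using K(2) unfolding H_def clique_def snd_conv by blast
  moreover have "\<Union>(snd H) \<subseteq> K" unfolding H_def snd_conv by blast
  ultimately show thesis using that fstH by metis
qed

text \<open>A dominating vertex outside a block reaches at most the connecting vertex of that block,
  so a block without a vertex of \<open>D\<close> retains a \<open>k\<close>-clique.\<close>
lemma B_graph_lower_bound:
  assumes iso: "graph_iso (V, E) (B_graph n k)" and i: "i \<in> {1, 2, 3}"
    and D: "isolating (V, E) (fam i k) D"
  shows "n div (k + 1) \<le> card D"
proof -
  obtain f where f: "bij_betw f V (fst (B_graph n k))"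
    and e: "\<And>u w. u \<in> V \<Longrightarrow> w \<in> V \<Longrightarrow> {u, w} \<in> E \<longleftrightarrow> {f u, f w} \<in> snd (B_graph n k)"
    using iso unfolding graph_iso_def fst_conv snd_conv by blast
  have "fst (B_graph n k) = {0..<n}" by (simp add: B_graph_def)
  note f = f[unfolded this]
  have DV: "D \<subseteq> V" using D by (simp add: isolating_def)
  \<comment> \<open>An edge leaves a block only from its connecting vertex, a multiple of
    \<open>k + 1\<close>.\<close>
  have block: "f u div (k + 1) = f w div (k + 1) \<or> f u mod (k + 1) = 0"
    if "u \<in> V" "w \<in> V" "{u, w} \<in> E" for u w
  proof -
    have "{f u, f w} \<in> snd (B_graph n k)" using e[of u w] that by blast
    then consider a b where "{f u, f w} = {a, b}" "a div (k + 1) = b div (k + 1)"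
      | j where "{f u, f w} = {j * (k + 1), (j + 1) * (k + 1)}"
      unfolding B_graph_def snd_conv by blast
    then show ?thesis
    proof cases
      case 1
      then show ?thesis by (auto simp: doubleton_eq_iff)
    next
      case (2 j)
      then have "\<exists>t. f u = t * (k + 1)" by (auto simp only: doubleton_eq_iff)
      then show ?thesis by (metis mod_mult_self2_is_0)
    qed
  qed
  have "j \<in> (\<lambda>d. f d div (k + 1)) ` D" if j: "j < n div (k + 1)" for j
  proof (rule ccontr)
    assume nj: "j \<notin> (\<lambda>d. f d div (k + 1)) ` D"
    \<comment> \<open>Block \<open>j\<close> without its connecting vertex. As \<open>j\<close> is
      below the quotient, the block is complete and \<open>K\<close> has exactly \<open>k\<close>
      vertices.\<close>
    define K where "K = {u \<in> V. f u \<in> {j * (k + 1) + 1..j * (k + 1) + k}}"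
    have "(j + 1) * (k + 1) \<le> n div (k + 1) * (k + 1)" using j by (intro mult_le_mono1) simp
    also have "\<dots> \<le> n" by (rule div_times_less_eq_dividend)
    finally have n: "j * (k + 1) + k < n" by simp
    have div_mod: "f u div (k + 1) = j \<and> f u mod (k + 1) \<noteq> 0" if "u \<in> K" for u
    proof -
      have u: "f u \<in> {j * (k + 1) + 1..j * (k + 1) + k}" using that by (simp add: K_def)
      define t where "t = f u - j * (k + 1)"
      have t: "f u = j * (k + 1) + t" "1 \<le> t" "t \<le> k" using u by (auto simp: t_def)
      have "(t + j * (k + 1)) div (k + 1) = j + t div (k + 1)"
        "(t + j * (k + 1)) mod (k + 1) = t mod (k + 1)"
        by (simp_all only: div_mult_self1 mod_mult_self1)
      then show ?thesis using t by (simp add: add.commute)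
    qed
    have img: "f ` K = {j * (k + 1) + 1..j * (k + 1) + k}"
    proof -
      have "{j * (k + 1) + 1..j * (k + 1) + k} \<subseteq> f ` V" using f n by (auto simp: bij_betw_def)
      then show ?thesis unfolding K_def by blast
    qed
    have "inj_on f K" using f by (auto simp: bij_betw_def K_def inj_on_def)
    then have cK: "card K = k" using card_image[of f K] img by simp
    have KV: "K \<subseteq> V" and finK: "finite K" using finite_V by (auto simp: K_def)
    have "clique K"
      unfolding clique_def
    proof (intro ballI impI)
      fix u w assume u: "u \<in> K" "w \<in> K" "u \<noteq> w"
      then have "u \<in> V" "w \<in> V" using KV by auto
      then have "f u < n" "f w < n" using bij_betwE[OF f] by auto
      moreover have "f u \<noteq> f w" using f KV u by (auto simp: bij_betw_def inj_on_def)
      moreover have "f u div (k + 1) = f w div (k + 1)" using div_mod u by simp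
      ultimately have "{f u, f w} \<in> snd (B_graph n k)"
        unfolding B_graph_def snd_conv by blast
      then show "{u, w} \<in> E" using e[of u w] KV u by blast
    qed
    then obtain H where H: "wf_graph H" "fst H = K" "snd H \<subseteq> E" "\<Union>(snd H) \<subseteq> K"
      "fam i k H"
      using clique_in_fam[OF finK _ cK i] by metis
    have out: "K \<inter> closed_nbhd (V, E) D = {}"
    proof -
      have False if u: "u \<in> K" "u \<in> closed_nbhd (V, E) D" for u
      proof -
        obtain d where d: "d \<in> D" "u = d \<or> {u, d} \<in> E"
          using u(2) by (auto simp: closed_nbhd_def insert_commute)
        then have "u \<in> V" "d \<in> V" using KV DV u(1) by auto
        \<comment> \<open>The nonzero residue of \<open>f u\<close> rules out an edge to another
          block.\<close>
        then have "f d div (k + 1) = j"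
          using block[of u d] div_mod[OF u(1)] d(2) by auto
        then show False using nj d by blast
      qed
      then show ?thesis by blast
    qed
    have "snd H \<subseteq> {e \<in> E. e \<inter> closed_nbhd (V, E) D = {}}" using H(3,4) out by blast
    moreover have "fst H \<subseteq> V - closed_nbhd (V, E) D" using H(2) KV out by blast
    ultimately have "subgraph H (delete_vertices (V, E) (closed_nbhd (V, E) D))"
      using H(1) by (simp add: subgraph_def delete_vertices_def)
    then show False using D H(5) unfolding isolating_def by blast
  qed
  \<comment> \<open>Every complete block contains a vertex of \<open>D\<close>, and distinct blocks
    need distinct vertices.\<close>
  then have "{..<n div (k + 1)} \<subseteq> (\<lambda>d. f d div (k + 1)) ` D" by blast
  moreover have finD: "finite D" using DV finite_V by (rule finite_subset)
  ultimately have "card {..<n div (k + 1)} \<le> card ((\<lambda>d. f d div (k + 1)) ` D)"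
    by (intro card_mono) auto
  also have "\<dots> \<le> card D" using finD by (rule card_image_le)
  finally show ?thesis by simp
qed

end

theorem theorem5:
  fixes V :: "'a set" and E :: "'a set set" and k i :: nat
  assumes "wf_graph (V, E)"
    and "connected_graph (V, E)"
    and "k \<ge> 1"
    and "i \<in> {0, 1, 2, 3}"
    and "\<not> special (V, E) k"
  shows "iota (V, E) (fam i k) \<le> card V div (k + 1) \<and>
    ((i \<in> {1, 2, 3} \<and> graph_iso (V, E) (B_graph (card V) k))
       \<longrightarrow> iota (V, E) (fam i k) = card V div (k + 1))"
proof -
  interpret graph_isolation V E k using assms by unfold_locales
  have "good V"
    using good_of_connected[OF finite_V conn_V] special_if_exceptional assms by blast
  then obtain D where D: "D \<subseteq> V" "card D * (k + 1) \<le> card V" "sparse (V - nbhd D)"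
    by (auto simp: good_def)
  have iso: "isolating (V, E) (fam i k) D" using isolating_if_sparse D by blast
  then have "iota (V, E) (fam i k) \<le> card D" unfolding iota_def by (intro Least_le) blast
  also have "card D \<le> card V div (k + 1)" using D(2) by (simp add: less_eq_div_iff_mult_less_eq)
  finally have upper: "iota (V, E) (fam i k) \<le> card V div (k + 1)" .
  \<comment> \<open>The minimum is attained, so the lower bound applies to an isolating set of size
    \<open>iota\<close>.\<close>
  have "\<exists>D. isolating (V, E) (fam i k) D \<and> card D = iota (V, E) (fam i k)"
    unfolding iota_def by (rule LeastI[where k = "card D"]) (use iso in blast)
  then show ?thesis using upper B_graph_lower_bound[of "card V" i] by (metis le_antisym)
qed

end
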